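(* Let $M\ge 2$, let $\tau_1,\dots,\tau_k$ be the $k$ highest-priority tasks of an arbitrary-deadline sporadic task set scheduled by global fixed-priority preemptive scheduling on $M$ identical processors, and suppose that all jobs of $\tau_1,\dots,\tau_{k-1}$ always meet their deadlines. Task $\tau_k$ is schedulable if for every $\ell\in\mathbb{N}=\{1,2,\dots\}$ $$\frac{\ell C_k}{D_k'}+\sum_{i=1}^{k-1}\left(\frac{C_i-C_iU_i}{D_k'}+U_i\right)\le M-(M-1)U_{\delta,k}^{\max},\qquad D_k'=(\ell-1)T_k+D_k .$$
   Context: Model. There are $M\ge2$ identical unit-speed processors. A sporadic task $\tau_i$ has worst-case execution time $C_i>0$, minimum inter-arrival time $T_i>0$, relative deadline $D_i>0$ and utilization $U_i=C_i/T_i$; it is assumed that $C_i\le D_i$ and $U_i\le1$, with no relation required between $D_i$ and $T_i$ (arbitrary deadlines). Task $\tau_i$ releases an infinite sequence of jobs whose consecutive arrivals are at least $T_i$ apart; each job needs at most $C_i$ units of execution, and a job arriving at $t$ must finish by its absolute deadline $t+D_i$. Preemption and migration cost nothing. At any instant at most one job of each task executes, on at most one processor; jobs of the same task are executed in arrival order. Global fixed-priority preemptive scheduling: tasks have unique fixed priorities, $\tau_i$ having higher priority than $\tau_j$ iff $i<j$; at each instant, among the tasks having an arrived and unfinished job, the $M$ highest-priority ones (all of them if fewer than $M$) execute. A task is schedulable if in every schedule so produced, for every legal arrival sequence, all its jobs meet their deadlines. Notation. Density $\delta_i=C_i/\min\{D_i,T_i\}$; $U_{\delta,k}^{\max}=\max\{\max_{1\le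 i\le k-1}U_i,\ \delta_k\}$. *)

theory Defs
  imports "HOL-Analysis.Analysis"
begin

record task =
  wcet :: real
  period :: real
  deadline :: real

definition utilization :: "task \<Rightarrow> real" where
  "utilization x = wcet x / period x"

definition density :: "task \<Rightarrow> real" where
  "density x = wcet x / min (deadline x) (period x)"

definition valid_task :: "task \<Rightarrow> bool" where
  "valid_task x \<longleftrightarrow> 0 < wcet x \<and> 0 < period x \<and> 0 < deadline x \<and>
     wcet x \<le> deadline x \<and> utilization x \<le> 1"

(* Tasks of a task set are numbered 1, ..., n, a smaller number meaning a higher
   priority.  Only the values of ts at 1, ..., n matter. *)
definition U_max :: "(nat \<Rightarrow> task) \<Rightarrow> nat \<Rightarrow> real" where
  "U_max ts k = Max (insert (density (ts k)) ((\<lambda>i. utilization (ts i)) ` {1..<k}))"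

(* Job j of task i (j = 0, 1, ...) arrives at arr i j and needs cost i j units of
   execution. *)
type_synonym job_param = "nat \<Rightarrow> nat \<Rightarrow> real"

definition legal_jobs :: "nat \<Rightarrow> (nat \<Rightarrow> task) \<Rightarrow> job_param \<Rightarrow> job_param \<Rightarrow> bool" where
  "legal_jobs n ts arr cost \<longleftrightarrow> (\<forall>i\<in>{1..n}. \<forall>j.
     arr i j + period (ts i) \<le> arr i (Suc j) \<and> 0 \<le> cost i j \<and> cost i j \<le> wcet (ts i))"

(* sched p t is the job (task, index) that processor p executes at time t, or None
   if p idles; the processors are 0, ..., M - 1. *)
type_synonym schedule = "nat \<Rightarrow> real \<Rightarrow> (nat \<times> nat) option"

definition executes :: "nat \<Rightarrow> schedule \<Rightarrow> nat \<Rightarrow> nat \<Rightarrow> real \<Rightarrow> bool" where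
  "executes M sched i j t \<longleftrightarrow> (\<exists>p<M. sched p t = Some (i, j))"

(* Execution received before time t on the unit-speed processors. *)
definition service :: "nat \<Rightarrow> schedule \<Rightarrow> nat \<Rightarrow> nat \<Rightarrow> real \<Rightarrow> real" where
  "service M sched i j t = measure lebesgue {s. s < t \<and> executes M sched i j s}"

definition pending ::
  "nat \<Rightarrow> job_param \<Rightarrow> job_param \<Rightarrow> schedule \<Rightarrow> nat \<Rightarrow> nat \<Rightarrow> real \<Rightarrow> bool" where
  "pending M arr cost sched i j t \<longleftrightarrow> arr i j \<le> t \<and> service M sched i j t < cost i j"

definition active_tasks ::
  "nat \<Rightarrow> nat \<Rightarrow> job_param \<Rightarrow> job_param \<Rightarrow> schedule \<Rightarrow> real \<Rightarrow> nat set" where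
  "active_tasks n M arr cost sched t = {i\<in>{1..n}. \<exists>j. pending M arr cost sched i j t}"

(* The M least elements of A, or all of A if it has fewer than M elements. *)
definition highest_priority :: "nat \<Rightarrow> nat set \<Rightarrow> nat set" where
  "highest_priority M A = {i\<in>A. card {h\<in>A. h < i} < M}"

(* Since the jobs of a task are indexed in arrival order, the least pending index is
   the earliest unfinished job.  Measurability excludes pathological time sets, on
   which service would not be meaningful. *)
definition global_fp_schedule ::
  "nat \<Rightarrow> nat \<Rightarrow> job_param \<Rightarrow> job_param \<Rightarrow> schedule \<Rightarrow> bool" where
  "global_fp_schedule n M arr cost sched \<longleftrightarrow>
     (\<forall>i j. {t. executes M sched i j t} \<in> sets lebesgue) \<and>
     (\<forall>t p q i j j'. p < M \<longrightarrow> q < M \<longrightarrow> sched p t = Some (i, j) \<longrightarrow>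
        sched q t = Some (i, j') \<longrightarrow> p = q) \<and>
     (\<forall>t i j. executes M sched i j t \<longleftrightarrow>
        i \<in> highest_priority M (active_tasks n M arr cost sched t) \<and>
        j = (LEAST j'. pending M arr cost sched i j' t))"

definition meets_deadline ::
  "nat \<Rightarrow> (nat \<Rightarrow> task) \<Rightarrow> job_param \<Rightarrow> job_param \<Rightarrow> schedule \<Rightarrow> nat \<Rightarrow> nat \<Rightarrow> bool" where
  "meets_deadline M ts arr cost sched i j \<longleftrightarrow>
     cost i j \<le> service M sched i j (arr i j + deadline (ts i))"

definition schedulable :: "nat \<Rightarrow> nat \<Rightarrow> (nat \<Rightarrow> task) \<Rightarrow> nat \<Rightarrow> bool" where
  "schedulable n M ts i \<longleftrightarrow> (\<forall>arr cost sched.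
     legal_jobs n ts arr cost \<longrightarrow> global_fp_schedule n M arr cost sched \<longrightarrow>
     (\<forall>j. meets_deadline M ts arr cost sched i j))"

end

(* Let a job of task k miss its deadline at b, let its busy period start at a with the arrival
   of the job l - 1 positions earlier, and put mu = M - (M - 1) U_max.  Task k executes for less
   than l C_k <= U_max D' <= U_max (b - a) in [a, b), and whenever it does not, all M processors
   serve higher-priority tasks; so these tasks and task k together execute for more than
   mu (b - a) there.  Now push a back to the c <= a that maximizes the higher-priority work in
   [c, a) minus mu (a - c).  By this choice no higher-priority task i executed at a rate below
   U_i from the start of its busy period to c, since otherwise extending the window to that
   start would increase the maximum.  Hence carry-in is harmless: task i executes in [c, b) for
   at most C_i - C_i U_i + U_i (b - c).  The sum of these bounds contradicts the test for l,
   because b - c >= D'. *)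
theory Submission imports Defs begin

section \<open>Counting and measure preliminaries\<close>

lemma card_highest_priority:
  assumes "finite A" "M \<le> card A"
  shows "M \<le> card (highest_priority M A)"
  using assms
proof (induction A rule: finite_linorder_max_induct)
  case empty
  then show ?case by simp
next
  case (insert b A)
  \<comment> \<open>Elements enter in increasing order, so a new maximum changes no count for the
    old ones.\<close>
  have below: "{h \<in> insert b A. h < i} = {h \<in> A. h < i}" if "i \<in> A" for i
    using insert.hyps that by auto
  show ?case
  proof (cases "M \<le> card A")
    case True
    have "highest_priority M A \<subseteq> highest_priority M (insert b A)"
      unfolding highest_priority_def using below by auto
    moreover have "finite (highest_priority M (insert b A))"
      using insert.hyps by (simp add: highest_priority_def)
    ultimately show ?thesis
      using insert.IH[OF True] card_mono order_trans by blast
  next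
    case False
    have "card {h \<in> insert b A. h < i} < M" if "i \<in> insert b A" for i
    proof -
      have "{h \<in> insert b A. h < i} \<subseteq> A"
        using that insert.hyps by auto
      then show ?thesis
        using False card_mono[OF insert.hyps(1)] by (meson le_less_trans not_le)
    qed
    then have "highest_priority M (insert b A) = insert b A"
      unfolding highest_priority_def by blast
    then show ?thesis using insert.prems by simp
  qed
qed

lemma measure_Int_interval_le:
  fixes a b :: real
  assumes "S \<in> sets lebesgue" "a \<le> b"
  shows "S \<inter> {a..<b} \<in> lmeasurable" "measure lebesgue (S \<inter> {a..<b}) \<le> b - a"
proof -
  have "bounded (S \<inter> {a..<b})"
    using bounded_closed_interval[of a b] by (rule bounded_subset) auto
  then show "S \<inter> {a..<b} \<in> lmeasurable"
    by (rule bounded_set_imp_lmeasurable[OF _ sets.Int[OF assms(1)]]) simp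
  then have "measure lebesgue (S \<inter> {a..<b}) \<le> measure lebesgue {a..b}"
    by (intro measure_mono_fmeasurable) auto
  then show "measure lebesgue (S \<inter> {a..<b}) \<le> b - a"
    using assms by simp
qed

lemma continuous_on_if_increment_le:
  fixes f :: "real \<Rightarrow> real"
  assumes "\<And>a b. a \<in> S \<Longrightarrow> b \<in> S \<Longrightarrow> a \<le> b \<Longrightarrow> \<bar>f b - f a\<bar> \<le> b - a"
  shows "continuous_on S f"
proof -
  have "1-lipschitz_on S f"
  proof (rule lipschitz_onI)
    fix x y assume "x \<in> S" "y \<in> S"
    then show "dist (f x) (f y) \<le> 1 * dist x y"
      using assms[of x y] assms[of y x] by (cases "x \<le> y") (auto simp: dist_real_def)
  qed simp
  then show ?thesis by (rule lipschitz_on_continuous_on)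
qed

section \<open>Service and work in a fixed schedule\<close>

locale fp_schedule =
  fixes n M :: nat and ts :: "nat \<Rightarrow> task" and arr cost :: job_param and sched :: schedule
  assumes valid: "\<And>i. i \<in> {1..n} \<Longrightarrow> valid_task (ts i)"
    and legal: "legal_jobs n ts arr cost"
    and fp: "global_fp_schedule n M arr cost sched"
begin

definition runs :: "nat \<Rightarrow> real set" where
  "runs i = {s. \<exists>j. executes M sched i j s}"

definition work :: "nat \<Rightarrow> real \<Rightarrow> real \<Rightarrow> real" where
  "work i a b = measure lebesgue (runs i \<inter> {a..<b})"

abbreviation "pend \<equiv> pending M arr cost sched"
abbreviation "act \<equiv> active_tasks n M arr cost sched"
abbreviation "serv \<equiv> service M sched"
abbreviation "C i \<equiv> wcet (ts i)"
abbreviation "T i \<equiv> period (ts i)"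
abbreviation "D i \<equiv> deadline (ts i)"
abbreviation "U i \<equiv> utilization (ts i)"

lemma executes_iff:
  "executes M sched i j t \<longleftrightarrow> i \<in> highest_priority M (act t) \<and> j = (LEAST j'. pend i j' t)"
  using fp unfolding global_fp_schedule_def by blast

lemma executes_measurable: "{t. executes M sched i j t} \<in> sets lebesgue"
  using fp unfolding global_fp_schedule_def by blast

lemma runs_eq: "runs i = {s. i \<in> highest_priority M (act s)}"
  unfolding runs_def executes_iff by blast

lemma runs_measurable: "runs i \<in> sets lebesgue"
proof -
  have "runs i = (\<Union>j. {s. executes M sched i j s})"
    unfolding runs_def by blast
  then show ?thesis using executes_measurable by auto
qed

lemma executes_imp_pending: "pend i j t" if "executes M sched i j t"
proof -
  have "\<exists>j'. pend i j' t" and j: "j = (LEAST j'. pend i j' t)"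
    using that unfolding executes_iff highest_priority_def active_tasks_def by auto
  then show ?thesis using LeastI_ex by metis
qed

lemma executes_imp_earlier_not_pending:
  "\<not> pend i j' t" if "executes M sched i j t" "j' < j"
  using that not_less_Least unfolding executes_iff by blast

lemma task_params:
  assumes "i \<in> {1..n}"
  shows "0 < C i" "0 < T i" "0 < D i" "C i \<le> D i" "U i \<le> 1" "0 < U i" "U i * T i = C i"
  using valid[OF assms] unfolding valid_task_def utilization_def by auto

lemma cost_le: "i \<in> {1..n} \<Longrightarrow> cost i j \<le> C i"
  using legal unfolding legal_jobs_def by blast

lemma arr_diff: "i \<in> {1..n} \<Longrightarrow> arr i j + real q * T i \<le> arr i (j + q)"
proof (induction q)
  case (Suc q)
  then have "arr i (j + q) + T i \<le> arr i (Suc (j + q))"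
    using legal unfolding legal_jobs_def by blast
  then show ?case using Suc by (simp add: algebra_simps)
qed simp

lemma arr_mono:
  assumes "i \<in> {1..n}" "j \<le> j'"
  shows "arr i j \<le> arr i j'"
proof -
  have "0 \<le> real (j' - j) * T i"
    using task_params(2)[OF assms(1)] by simp
  then show ?thesis using arr_diff[OF assms(1), of j "j' - j"] assms(2) by simp
qed

lemma arr_unbounded:
  assumes "i \<in> {1..n}"
  obtains j where "t < arr i j"
proof -
  obtain q where "t - arr i 0 < real q * T i"
    using reals_Archimedean3 task_params(2)[OF assms] by blast
  then show ?thesis using arr_diff[OF assms, of 0 q] that[of q] by simp
qed

lemma service_add:
  assumes "a \<le> b"
  shows "serv i j b = serv i j a + measure lebesgue ({s. executes M sched i j s} \<inter> {a..<b})"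
proof -
  \<comment> \<open>No job executes before its arrival, so this set is bounded and has finite
    measure; \<open>measure\<close> is 0 on sets of infinite measure, which would break
    additivity.\<close>
  have "{s. s < a \<and> executes M sched i j s} \<subseteq> {arr i j..a}"
    using executes_imp_pending unfolding pending_def by force
  then have "bounded {s. s < a \<and> executes M sched i j s}"
    using bounded_closed_interval bounded_subset by blast
  moreover have "{s. s < a \<and> executes M sched i j s} = {..<a} \<inter> {s. executes M sched i j s}"
    by auto
  ultimately have 1: "{s. s < a \<and> executes M sched i j s} \<in> lmeasurable"
    using bounded_set_imp_lmeasurable[OF _ sets.Int[OF _ executes_measurable]] by simp
  have 2: "{s. executes M sched i j s} \<inter> {a..<b} \<in> lmeasurable"
    using measure_Int_interval_le(1)[OF executes_measurable assms] .
  have "{s. s < b \<and> executes M sched i j s} =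
      {s. s < a \<and> executes M sched i j s} \<union> ({s. executes M sched i j s} \<inter> {a..<b})"
    using assms by auto
  then show ?thesis
    unfolding service_def by (simp only:) (rule measure_Un_AE[OF AE_I2 1 2], auto)
qed

lemma service_mono: "a \<le> b \<Longrightarrow> serv i j a \<le> serv i j b"
  by (simp add: service_add)

lemma continuous_on_service: "continuous_on S (serv i j)"
proof (rule continuous_on_if_increment_le)
  fix a b :: real assume "a \<le> b"
  then show "\<bar>serv i j b - serv i j a\<bar> \<le> b - a"
    using measure_Int_interval_le(2)[OF executes_measurable] by (simp add: service_add)
qed

text \<open>A job executes only while its service is below its cost. By continuity an excess would
  have to pass through equality, after which the job never executes again.\<close>

lemma service_le_cost:
  assumes "i \<in> {1..n}"
  shows "serv i j t \<le> cost i j"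
proof (rule ccontr)
  assume "\<not> ?thesis"
  then have gt: "cost i j < serv i j t" by simp
  \<comment> \<open>The intermediate value theorem needs a point at or before \<open>t\<close> with
    zero service.\<close>
  have "{s. s < min t (arr i j) \<and> executes M sched i j s} = {}"
    using executes_imp_pending unfolding pending_def by force
  then have "serv i j (min t (arr i j)) = 0"
    unfolding service_def by (metis measure_empty)
  moreover have "0 \<le> cost i j"
    using legal assms unfolding legal_jobs_def by blast
  ultimately have "\<exists>s\<ge>min t (arr i j). s \<le> t \<and> serv i j s = cost i j"
    using gt by (intro IVT' continuous_on_service) auto
  then obtain s where s: "s \<le> t" "serv i j s = cost i j" by blast
  have "\<not> executes M sched i j u" if "s \<le> u" for u
    using executes_imp_pending[of i j u] service_mono[OF that, of i j] s(2)
    unfolding pending_def by auto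
  then have "{u. executes M sched i j u} \<inter> {s..<t} = {}" by auto
  then have "serv i j t = serv i j s"
    using service_add[OF s(1), of i j] by simp
  then show False using gt s by simp
qed

lemma work_le: "a \<le> b \<Longrightarrow> work i a b \<le> b - a"
  unfolding work_def by (rule measure_Int_interval_le(2)[OF runs_measurable])

lemma work_nonneg: "0 \<le> work i a b"
  unfolding work_def by simp

lemma work_add:
  assumes "a \<le> b" "b \<le> c"
  shows "work i a c = work i a b + work i b c"
proof -
  have "runs i \<inter> {a..<c} = (runs i \<inter> {a..<b}) \<union> (runs i \<inter> {b..<c})"
    using assms by auto
  then show ?thesis
    unfolding work_def
    by (simp only:) (rule measure_Un_AE[OF AE_I2], auto simp: measure_Int_interval_le(1) runs_measurable assms)
qed

text \<open>A union bound reduces each estimate of work to choosing a finite set of jobs that covers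
  all execution in the window.\<close>

lemma work_le_sum_jobs:
  assumes "a \<le> b" "finite J"
    and "\<And>j s. executes M sched i j s \<Longrightarrow> a \<le> s \<Longrightarrow> s < b \<Longrightarrow> j \<in> J"
  shows "work i a b \<le> (\<Sum>j\<in>J. serv i j b - serv i j a)"
proof -
  have "work i a b \<le> measure lebesgue (\<Union>j\<in>J. {s. executes M sched i j s} \<inter> {a..<b})"
    unfolding work_def
  proof (rule measure_mono_fmeasurable)
    show "runs i \<inter> {a..<b} \<subseteq> (\<Union>j\<in>J. {s. executes M sched i j s} \<inter> {a..<b})"
      using assms(3) unfolding runs_def by force
    show "runs i \<inter> {a..<b} \<in> sets lebesgue"
      using runs_measurable by auto
    show "(\<Union>j\<in>J. {s. executes M sched i j s} \<inter> {a..<b}) \<in> lmeasurable"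
      using assms measure_Int_interval_le(1)[OF executes_measurable]
      by (intro fmeasurable.finite_UN) auto
  qed
  also have "\<dots> \<le> (\<Sum>j\<in>J. measure lebesgue ({s. executes M sched i j s} \<inter> {a..<b}))"
    using assms measure_Int_interval_le(1)[OF executes_measurable]
    by (intro measure_UNION_le) auto
  also have "\<dots> = (\<Sum>j\<in>J. serv i j b - serv i j a)"
    using service_add[OF assms(1)] by simp
  finally show ?thesis .
qed

text \<open>The bound is the concave majorant of the work of jobs released as densely as possible
  from \<open>a\<close> on: the extremal window ends when the last job has just executed for \<open>C i\<close>.\<close>

lemma work_no_carry_in:
  assumes i: "i \<in> {1..n}" and ab: "a \<le> b"
    and completed: "\<And>j. j < j0 \<Longrightarrow> cost i j \<le> serv i j a" and j0: "a \<le> arr i j0"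
  shows "work i a b \<le> C i - C i * U i + U i * (b - a)"
proof (cases "arr i j0 < b")
  case False
  \<comment> \<open>Jobs before \<open>j0\<close> are complete and the others arrive too late, so no
    work is done; the claimed bound is nonnegative because \<open>U i \<le> 1\<close>.\<close>
  have "work i a b \<le> (\<Sum>j\<in>{}. serv i j b - serv i j a)"
  proof (rule work_le_sum_jobs[OF ab])
    fix j s assume e: "executes M sched i j s" "a \<le> s" "s < b"
    then have "arr i j \<le> s" "serv i j s < cost i j"
      using executes_imp_pending unfolding pending_def by auto
    then have "j < j0" using False e arr_mono[OF i, of j0 j] by force
    then show "j \<in> {}"
      using completed[of j] service_mono[OF e(2), of i j] \<open>serv i j s < cost i j\<close> by simp
  qed simp
  moreover have "0 \<le> C i * (1 - U i)" "0 \<le> U i * (b - a)"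
    using task_params[OF i] ab by auto
  ultimately show ?thesis by (simp add: algebra_simps)
next
  case True
  obtain N where N: "b < arr i N" using arr_unbounded[OF i] .
  \<comment> \<open>\<open>l\<close> is the first job arriving at or after \<open>b\<close>, so only
    jobs \<open>j0\<close> to \<open>l - 1 = j0 + q\<close> can execute in the window.\<close>
  define l where "l = (LEAST j. b \<le> arr i j)"
  have l: "b \<le> arr i l" unfolding l_def by (rule LeastI[of _ N]) (use N in simp)
  have below: "arr i j < b" if "j < l" for j
    using not_less_Least[of j "\<lambda>j. b \<le> arr i j"] that unfolding l_def by simp
  have "j0 < l" using True l arr_mono[OF i, of l j0] by force
  then obtain q where q: "l = Suc (j0 + q)" using less_imp_Suc_add by blast
  let ?x = "b - a - real q * T i" and ?m = "arr i (j0 + q)"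
  have m: "a + real q * T i \<le> ?m" "?m < b"
    using arr_diff[OF i, of j0 q] j0 below[of "j0 + q"] q by auto
  have inc: "serv i j b - serv i j a \<le> C i" for j
    using service_le_cost[OF i, of j b] cost_le[OF i, of j] measure_nonneg
    unfolding service_def by (smt (verit))
  have last: "serv i (j0 + q) b - serv i (j0 + q) a \<le> ?x"
  proof -
    have "{s. executes M sched i (j0 + q) s} \<inter> {a..<?m} = {}"
      using executes_imp_pending unfolding pending_def by force
    moreover have "a \<le> ?m" using m(1) task_params(2)[OF i] by (smt (verit) mult_nonneg_nonneg of_nat_0_le_iff)
    ultimately have "serv i (j0 + q) ?m = serv i (j0 + q) a"
      using service_add[of a ?m i "j0 + q"] by simp
    then show ?thesis
      using m measure_Int_interval_le(2)[OF executes_measurable, of ?m b i "j0 + q"]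
        service_add[of ?m b i "j0 + q"] by simp
  qed
  have "work i a b \<le> (\<Sum>j\<in>{j0..j0 + q}. serv i j b - serv i j a)"
  proof (rule work_le_sum_jobs[OF ab])
    fix j s assume e: "executes M sched i j s" "a \<le> s" "s < b"
    then have "arr i j \<le> s" "serv i j s < cost i j"
      using executes_imp_pending unfolding pending_def by auto
    then have "j0 \<le> j"
      using completed[of j] service_mono[OF e(2), of i j] by force
    moreover have "j < l"
      using l e \<open>arr i j \<le> s\<close> arr_mono[OF i, of l j] by force
    ultimately show "j \<in> {j0..j0 + q}" using q by simp
  qed simp
  also have "\<dots> = (\<Sum>j\<in>{j0..<j0 + q}. serv i j b - serv i j a) +
      (serv i (j0 + q) b - serv i (j0 + q) a)"
    by (simp add: sum.last_plus atLeastLessThanSuc_atLeastAtMost[symmetric])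
  also have "(\<Sum>j\<in>{j0..<j0 + q}. serv i j b - serv i j a) \<le> real q * C i"
    using sum_bounded_above[of "{j0..<j0 + q}" "\<lambda>j. serv i j b - serv i j a" "C i"] inc by simp
  \<comment> \<open>The bounds \<open>C i\<close> and \<open>?x\<close> are combined with weights
    \<open>1 - U i\<close> and \<open>U i\<close>; then \<open>U i * T i = C i\<close> cancels
    \<open>q\<close>.\<close>
  also have "serv i (j0 + q) b - serv i (j0 + q) a \<le> (1 - U i) * C i + U i * ?x"
  proof -
    let ?d = "serv i (j0 + q) b - serv i (j0 + q) a"
    have "(1 - U i) * ?d \<le> (1 - U i) * C i" "U i * ?d \<le> U i * ?x"
      using inc[of "j0 + q"] last task_params[OF i] by (auto intro!: mult_left_mono)
    then show ?thesis by (simp add: algebra_simps)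
  qed
  also have "real q * C i + ((1 - U i) * C i + U i * ?x) = C i - C i * U i + U i * (b - a)"
    using task_params(7)[OF i] by (simp add: algebra_simps)
  finally show ?thesis by simp
qed

section \<open>Busy periods, blocking and carry-in\<close>

text \<open>Take the latest job up to \<open>j\<close> at whose arrival all predecessors are
  complete. At each later arrival up to that of \<open>j\<close> some predecessor is unfinished, so
  the task stays active.\<close>

lemma busy_period:
  assumes i: "i \<in> {1..n}" and p: "pend i j t"
  obtains j0 where "j0 \<le> j" "\<And>j'. j' < j0 \<Longrightarrow> cost i j' \<le> serv i j' (arr i j0)"
    "\<And>s. arr i j0 \<le> s \<Longrightarrow> s \<le> t \<Longrightarrow> i \<in> act s"
proof -
  let ?P = "\<lambda>m. m \<le> j \<and> (\<forall>j'<m. cost i j' \<le> serv i j' (arr i m))"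
  define j0 where "j0 = (GREATEST m. ?P m)"
  have P0: "?P j0" unfolding j0_def by (rule GreatestI_nat[of ?P 0 j]) auto
  have max: "m \<le> j0" if "?P m" for m
    unfolding j0_def by (rule Greatest_le_nat[of ?P m j]) (use that in auto)
  have "i \<in> act s" if s: "arr i j0 \<le> s" "s \<le> t" for s
  proof -
    \<comment> \<open>\<open>m\<close> is the last job up to \<open>j\<close> that has arrived by
      \<open>s\<close>. If it is \<open>j\<close>, then \<open>j\<close> itself is pending at
      \<open>s\<close>; otherwise a job up to \<open>m\<close> is still unfinished at the arrival of
      \<open>Suc m\<close>, which lies after \<open>s\<close>.\<close>
    define m where "m = (GREATEST m. m \<le> j \<and> arr i m \<le> s)"
    have m: "m \<le> j" "arr i m \<le> s"
      using GreatestI_nat[of "\<lambda>m. m \<le> j \<and> arr i m \<le> s" j0 j] P0 s unfolding m_def by auto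
    have mmax: "m' \<le> m" if "m' \<le> j" "arr i m' \<le> s" for m'
      unfolding m_def by (rule Greatest_le_nat[of _ m' j]) (use that in auto)
    have "\<exists>j'. pend i j' s"
    proof (cases "m = j")
      case True
      then show ?thesis using m p service_mono[OF s(2), of i j] unfolding pending_def by force
    next
      case False
      then have "Suc m \<le> j" using m by simp
      then have late: "s < arr i (Suc m)" using mmax[of "Suc m"] by force
      have "\<not> ?P (Suc m)" using max[of "Suc m"] mmax[of j0] P0 s by auto
      then obtain j' where j': "j' < Suc m" "serv i j' (arr i (Suc m)) < cost i j'"
        using \<open>Suc m \<le> j\<close> by force
      then have "pend i j' s"
        using service_mono[of s "arr i (Suc m)" i j'] late arr_mono[OF i, of j' m] m
        unfolding pending_def by simp
      then show ?thesis by blast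
    qed
    then show ?thesis using i unfolding active_tasks_def by simp
  qed
  then show ?thesis using that P0 by blast
qed

text \<open>An active task that does not execute is blocked by \<open>M\<close> executing tasks of higher priority.\<close>

lemma work_blocking:
  assumes ab: "a \<le> b" and act: "\<And>s. a \<le> s \<Longrightarrow> s < b \<Longrightarrow> i \<in> act s"
  shows "real M * (b - a - work i a b) \<le> (\<Sum>h\<in>{1..<i}. work h a b)"
proof -
  have meas: "runs h \<inter> {a..<b} \<in> lmeasurable" for h
    using measure_Int_interval_le(1)[OF runs_measurable ab] .
  have meas': "{a..<b} \<in> lmeasurable"
    using measure_Int_interval_le(1)[of UNIV a b] ab by simp
  have int: "integrable lebesgue (indicator (runs h \<inter> {a..<b}) :: real \<Rightarrow> real)"
    "integral\<^sup>L lebesgue (indicator (runs h \<inter> {a..<b})) = work h a b" for h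
    using meas[of h] unfolding work_def fmeasurable_def by auto
  have int': "integrable lebesgue (indicator {a..<b} :: real \<Rightarrow> real)"
    "integral\<^sup>L lebesgue (indicator {a..<b}) = b - a"
    using meas' ab unfolding fmeasurable_def by auto
  \<comment> \<open>Pointwise form of the claim, to be integrated: whenever task \<open>i\<close>
    does not run in the window, at least \<open>M\<close> tasks of higher priority do.\<close>
  have le: "real M * (indicator {a..<b} s - indicator (runs i \<inter> {a..<b}) s) \<le>
      (\<Sum>h\<in>{1..<i}. indicator (runs h \<inter> {a..<b}) s)" for s :: real
  proof (cases "s \<in> {a..<b} \<and> s \<notin> runs i")
    case True
    define B where "B = {h \<in> act s. h < i}"
    have fin: "finite B" unfolding B_def active_tasks_def by simp
    have "M \<le> card B"
      using True act unfolding runs_eq highest_priority_def B_def by auto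
    then have "M \<le> card (highest_priority M B)" by (rule card_highest_priority[OF fin])
    also have "\<dots> \<le> card {h\<in>{1..<i}. s \<in> runs h}"
    proof (rule card_mono)
      \<comment> \<open>Dropping the tasks from \<open>i\<close> on leaves unchanged the counts that
        decide selection below \<open>i\<close>, so tasks selected from \<open>B\<close> really
        run.\<close>
      have "{g \<in> B. g < h} = {g \<in> act s. g < h}" if "h < i" for h
        using that unfolding B_def by auto
      then show "highest_priority M B \<subseteq> {h\<in>{1..<i}. s \<in> runs h}"
        unfolding runs_eq highest_priority_def by (auto simp: B_def active_tasks_def)
    qed simp
    finally have "M \<le> card {h\<in>{1..<i}. s \<in> runs h}" .
    moreover have "(\<Sum>h\<in>{1..<i}. indicator (runs h \<inter> {a..<b}) s) =
        real (card {h\<in>{1..<i}. s \<in> runs h})"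
      using True by (simp add: indicator_def sum.If_cases Int_def)
    ultimately show ?thesis using True by simp
  next
    case False
    then show ?thesis by (auto simp: indicator_def sum_nonneg)
  qed
  have "real M * (b - a - work i a b) =
      integral\<^sup>L lebesgue (\<lambda>s. real M * (indicator {a..<b} s - indicator (runs i \<inter> {a..<b}) s))"
    using int int' by simp
  also have "\<dots> \<le> integral\<^sup>L lebesgue (\<lambda>s. \<Sum>h\<in>{1..<i}. indicator (runs h \<inter> {a..<b}) s)"
    using int int' le by (intro integral_mono) auto
  also have "\<dots> = (\<Sum>h\<in>{1..<i}. work h a b)"
    using int by (simp add: Bochner_Integration.integral_sum)
  finally show ?thesis .
qed

text \<open>The hypothesis \<open>light\<close> forces a task that is active at \<open>a\<close> to have executed at least at
  the rate of its utilization since the start of its busy period, so that its carry-in does not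
  increase the bound.\<close>

lemma work_with_carry_in:
  assumes M: "2 \<le> M" and i: "i \<in> {1..<k}" and k: "k \<le> n" and ab: "a \<le> b"
    and \<rho>: "U i \<le> \<rho>"
    and light: "\<And>j. arr i j \<le> a \<Longrightarrow>
      (\<Sum>h\<in>{1..<k}. work h (arr i j) a) \<le> (real M - (real M - 1) * \<rho>) * (a - arr i j)"
  shows "work i a b \<le> C i - C i * U i + U i * (b - a)"
proof (cases "\<exists>j. pend i j a")
  case False
  have i': "i \<in> {1..n}" using i k by auto
  obtain N where N: "a < arr i N" using arr_unbounded[OF i'] .
  define l where "l = (LEAST j. a \<le> arr i j)"
  have "a \<le> arr i l" unfolding l_def by (rule LeastI[of _ N]) (use N in simp)
  moreover have "cost i j \<le> serv i j a" if "j < l" for j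
    using not_less_Least[of j "\<lambda>j. a \<le> arr i j"] that False unfolding l_def pending_def
    by (auto simp: not_le dest: less_imp_le spec[of _ j])
  ultimately show ?thesis by (intro work_no_carry_in[OF i' ab])
next
  case True
  have i': "i \<in> {1..n}" using i k by auto
  obtain j where j: "pend i j a" using True by blast
  obtain j0 where j0: "j0 \<le> j" "\<And>j'. j' < j0 \<Longrightarrow> cost i j' \<le> serv i j' (arr i j0)"
    "\<And>s. arr i j0 \<le> s \<Longrightarrow> s \<le> a \<Longrightarrow> i \<in> act s"
    using busy_period[OF i' j] by blast
  let ?c = "arr i j0"
  have ca: "?c \<le> a" using arr_mono[OF i' j0(1)] j unfolding pending_def by simp
  \<comment> \<open>Blocking bounds the higher-priority work from below by \<open>M\<close> times
    the time during which \<open>i\<close> does not run. Compared with \<open>light\<close>, this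
    forces rate at least \<open>\<rho>\<close> on task \<open>i\<close>, after division by
    \<open>M - 1 > 0\<close>.\<close>
  have "real M * (a - ?c - work i ?c a) + work i ?c a \<le> (\<Sum>h\<in>insert i {1..<i}. work h ?c a)"
    using work_blocking[OF ca, of i] j0(3) by simp
  also have "\<dots> \<le> (\<Sum>h\<in>{1..<k}. work h ?c a)"
    using i by (intro sum_mono2) (auto simp: work_nonneg)
  also have "\<dots> \<le> (real M - (real M - 1) * \<rho>) * (a - ?c)" using light[OF ca] .
  finally have "(real M - 1) * (\<rho> * (a - ?c)) \<le> (real M - 1) * work i ?c a"
    by (simp add: algebra_simps)
  then have "\<rho> * (a - ?c) \<le> work i ?c a" using M by simp
  moreover have "U i * (a - ?c) \<le> \<rho> * (a - ?c)" using \<rho> ca by (intro mult_right_mono) auto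
  \<comment> \<open>There is no carry-in at \<open>?c\<close>; subtracting the work done before
    \<open>a\<close>, at least \<open>U i * (a - ?c)\<close>, gives the bound from \<open>a\<close>
    on.\<close>
  moreover have "work i ?c b \<le> C i - C i * U i + U i * (b - ?c)"
    using work_no_carry_in[OF i' _ j0(2)] ca ab by simp
  moreover have "work i ?c b = work i ?c a + work i a b" using work_add[OF ca ab] .
  ultimately show ?thesis by (simp add: algebra_simps)
qed

section \<open>Contradiction from a missed deadline\<close>

text \<open>Only jobs \<open>j0\<close> to \<open>j\<close> can execute: earlier ones are complete,
  and later ones wait for \<open>j\<close>, which is unfinished at \<open>b\<close>. This last fact
  also makes the inequality strict.\<close>

lemma work_before_missed_deadline:
  assumes k: "k \<in> {1..n}" and ab: "arr k j0 \<le> b" and j: "j0 \<le> j" and p: "pend k j b"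
    and completed: "\<And>j'. j' < j0 \<Longrightarrow> cost k j' \<le> serv k j' (arr k j0)"
  shows "work k (arr k j0) b < real (Suc (j - j0)) * C k"
proof -
  let ?a = "arr k j0"
  have "work k ?a b \<le> (\<Sum>j'\<in>{j0..j}. serv k j' b - serv k j' ?a)"
  proof (rule work_le_sum_jobs[OF ab])
    fix j' s assume e: "executes M sched k j' s" "?a \<le> s" "s < b"
    then have e': "arr k j' \<le> s" "serv k j' s < cost k j'"
      using executes_imp_pending unfolding pending_def by auto
    then have "j0 \<le> j'"
      using completed[of j'] service_mono[OF e(2), of k j'] by force
    moreover have "j' \<le> j"
    proof (rule ccontr)
      assume "\<not> j' \<le> j"
      then have "j < j'" by simp
      then have "pend k j s"
        using p e e' service_mono[of s b k j] arr_mono[OF k, of j j'] unfolding pending_def by simp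
      then show False using executes_imp_earlier_not_pending e(1) \<open>j < j'\<close> by blast
    qed
    ultimately show "j' \<in> {j0..j}" by simp
  qed simp
  also have "\<dots> < (\<Sum>j'\<in>{j0..j}. C k)"
  proof (rule sum_strict_mono_ex1)
    have nn: "0 \<le> serv k j' ?a" for j' unfolding service_def by simp
    show "\<forall>j'\<in>{j0..j}. serv k j' b - serv k j' ?a \<le> C k"
      using service_le_cost[OF k] cost_le[OF k] nn by (smt (verit))
    show "\<exists>j'\<in>{j0..j}. serv k j' b - serv k j' ?a < C k"
      using p j nn[of j] cost_le[OF k, of j] unfolding pending_def
      by (intro bexI[of _ j]) auto
  qed simp
  finally show ?thesis using j by (simp add: Suc_diff_le)
qed

lemma deadline_met:
  assumes M: "2 \<le> M" and k: "k \<in> {1..n}"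
    and \<rho>: "density (ts k) \<le> \<rho>" "\<And>i. i \<in> {1..<k} \<Longrightarrow> U i \<le> \<rho>"
    and test: "\<And>l::nat. 1 \<le> l \<Longrightarrow>
      real l * C k / ((real l - 1) * T k + D k) +
      (\<Sum>i\<in>{1..<k}. (C i - C i * U i) / ((real l - 1) * T k + D k) + U i)
      \<le> real M - (real M - 1) * \<rho>"
  shows "meets_deadline M ts arr cost sched k j"
proof (rule ccontr)
  assume miss: "\<not> ?thesis"
  define b where "b = arr k j + D k"
  have p: "pend k j b"
    using miss task_params(3)[OF k] unfolding meets_deadline_def pending_def b_def by simp
  obtain j0 where j0: "j0 \<le> j" "\<And>j'. j' < j0 \<Longrightarrow> cost k j' \<le> serv k j' (arr k j0)"
    "\<And>s. arr k j0 \<le> s \<Longrightarrow> s \<le> b \<Longrightarrow> k \<in> act s"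
    using busy_period[OF k p] by blast
  \<comment> \<open>\<open>l\<close> counts the jobs from \<open>j0\<close> to \<open>j\<close>
    inclusive, so \<open>D'\<close> is the least possible distance from the arrival of
    \<open>j0\<close> to the deadline \<open>b\<close>.\<close>
  define a l D' \<mu> where "a = arr k j0" and "l = Suc (j - j0)"
    and "D' = (real l - 1) * T k + D k" and "\<mu> = real M - (real M - 1) * \<rho>"
  have Dle: "D' \<le> b - a"
    using arr_diff[OF k, of j0 "j - j0"] j0(1) unfolding D'_def b_def a_def l_def by simp
  have Dpos: "0 < D'"
    using task_params[OF k] unfolding D'_def l_def by (simp add: add_nonneg_pos)
  have ab: "a \<le> b" using Dle Dpos by simp
  have E: "work k a b < real l * C k"
    using work_before_missed_deadline[OF k _ j0(1) p j0(2)] ab unfolding a_def l_def by simp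
  have "0 < density (ts k)" using task_params[OF k] unfolding density_def by simp
  then have \<rho>nonneg: "0 \<le> \<rho>" using \<rho>(1) by simp
  \<comment> \<open>\<open>C k\<close> is the density times \<open>min (D k) (T k)\<close>, and
    \<open>l\<close> copies of this minimum fit into \<open>D'\<close>.\<close>
  have "real l * C k \<le> \<rho> * D'"
  proof -
    let ?m = "min (D k) (T k)"
    have m: "0 < ?m" using task_params[OF k] by simp
    have "C k = density (ts k) * ?m"
      using less_imp_neq[OF m] unfolding density_def by (metis nonzero_divide_eq_eq)
    also have "\<dots> \<le> \<rho> * ?m" using \<rho>(1) m by (intro mult_right_mono) auto
    finally have "real l * C k \<le> real l * (\<rho> * ?m)" by (intro mult_left_mono) auto
    also have "\<dots> = \<rho> * ((real l - 1) * ?m + ?m)" by (simp add: algebra_simps)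
    also have "\<dots> \<le> \<rho> * D'"
    proof (rule mult_left_mono)
      show "(real l - 1) * ?m + ?m \<le> D'"
        unfolding D'_def by (intro add_mono mult_left_mono) (auto simp: l_def)
    qed (rule \<rho>nonneg)
    finally show ?thesis .
  qed
  moreover have "\<rho> * D' \<le> \<rho> * (b - a)" using Dle \<rho>nonneg by (rule mult_left_mono)
  ultimately have E\<rho>: "work k a b < \<rho> * (b - a)" using E by simp

  define W where "W = (\<lambda>x y. \<Sum>h\<in>{1..<k}. work h x y)"
  have Wadd: "W x z = W x y + W y z" if "x \<le> y" "y \<le> z" for x y z
    unfolding W_def using work_add[OF that] by (simp add: sum.distrib)
  \<comment> \<open>A lower bound on the arrivals of tasks 1 to \<open>k\<close> makes the range of
    window starts compact while keeping every such arrival up to \<open>a\<close> in it.\<close>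
  define A where "A = Min ((\<lambda>i. arr i 0) ` {1..k})"
  have A: "A \<le> arr i m" if "i \<in> {1..k}" for i m
  proof -
    have "A \<le> arr i 0" unfolding A_def using that by (intro Min_le) auto
    also have "\<dots> \<le> arr i m" using that k by (intro arr_mono) auto
    finally show ?thesis .
  qed
  define F where "F = (\<lambda>x. W x a - \<mu> * (a - x))"
  have "continuous_on {A..a} (\<lambda>x. work h x a)" for h
  proof (rule continuous_on_if_increment_le)
    fix x y assume "x \<in> {A..a}" "y \<in> {A..a}" "x \<le> y"
    then show "\<bar>work h y a - work h x a\<bar> \<le> y - x"
      using work_add[of x y a h] work_le[of x y h] work_nonneg[of h x y] by simp
  qed
  then have "continuous_on {A..a} F" unfolding F_def W_def by (intro continuous_intros)
  moreover have "A \<le> a" unfolding a_def using A k by simp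
  ultimately obtain c where c: "c \<in> {A..a}" and cmax: "\<And>y. y \<in> {A..a} \<Longrightarrow> F y \<le> F c"
    using continuous_attains_sup[of "{A..a}" F] by auto
  have "work i c b \<le> C i - C i * U i + U i * (b - c)" if i: "i \<in> {1..<k}" for i
  proof (rule work_with_carry_in[OF M i _ _ \<rho>(2)[OF i]])
    fix m
    let ?d = "arr i m"
    assume d: "?d \<le> c"
    \<comment> \<open>Maximality of \<open>c\<close> is what \<open>light\<close> asks for:
      extending the window back to \<open>?d\<close> adds at most \<open>\<mu> * (c - ?d)\<close> of
      work.\<close>
    have "F ?d \<le> F c" using cmax A[of i m] d i c by simp
    then show "(\<Sum>h\<in>{1..<k}. work h ?d c) \<le> (real M - (real M - 1) * \<rho>) * (c - ?d)"
      using Wadd[of ?d c a] d c unfolding F_def W_def \<mu>_def by (simp add: algebra_simps)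
  qed (use k c ab in auto)
  then have upper: "W c b \<le> (\<Sum>i\<in>{1..<k}. C i - C i * U i + U i * (b - c))"
    unfolding W_def by (rule sum_mono)
  \<comment> \<open>Comparison with the empty window, where \<open>F a = 0\<close>.\<close>
  have "\<mu> * (a - c) \<le> W c a"
    using cmax[of a] \<open>A \<le> a\<close> unfolding F_def W_def work_def by simp
  moreover have "real M * (b - a - work k a b) \<le> W a b"
    unfolding W_def using work_blocking[OF ab, of k] j0(3) unfolding a_def by simp
  \<comment> \<open>Adding \<open>work k a b\<close> to the blocking bound gives
    \<open>M * (b - a) - (M - 1) * work k a b\<close>, which by this inequality exceeds
    \<open>\<mu> * (b - a)\<close>.\<close>
  moreover have "(real M - 1) * work k a b < (real M - 1) * (\<rho> * (b - a))"
    using E\<rho> M by simp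
  ultimately have "\<mu> * (b - c) < W c b + work k a b"
    using Wadd[of c a b] c ab unfolding \<mu>_def by (simp add: algebra_simps)
  also have "\<dots> < (\<Sum>i\<in>{1..<k}. C i - C i * U i + U i * (b - c)) + real l * C k"
    using upper E by simp
  also have "\<dots> = real l * C k + (\<Sum>i\<in>{1..<k}. C i - C i * U i) + (\<Sum>i\<in>{1..<k}. U i) * (b - c)"
    by (simp add: sum.distrib sum_distrib_right)
  finally have lower: "\<mu> * (b - c) <
      real l * C k + (\<Sum>i\<in>{1..<k}. C i - C i * U i) + (\<Sum>i\<in>{1..<k}. U i) * (b - c)" .

  \<comment> \<open>\<open>S\<close> collects the terms independent of the window length. The test
    is stated for length \<open>D'\<close>; it carries over to \<open>b - c \<ge> D'\<close> because
    \<open>S \<ge> 0\<close> makes \<open>S / D' * (b - c)\<close> at least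
    \<open>S\<close>.\<close>
  define S where "S = real l * C k + (\<Sum>i\<in>{1..<k}. C i - C i * U i)"
  have L: "D' \<le> b - c" using Dle c by simp
  have Spos: "0 \<le> S"
  proof -
    have "0 \<le> C i - C i * U i" if "i \<in> {1..<k}" for i
      using task_params[of i] that k by (simp add: mult_left_le)
    then show ?thesis
      unfolding S_def using task_params(1)[OF k] by (intro add_nonneg_nonneg sum_nonneg) auto
  qed
  have "S / D' + (\<Sum>i\<in>{1..<k}. U i) \<le> \<mu>"
    using test[of l] unfolding S_def \<mu>_def D'_def
    by (simp add: l_def sum.distrib add_divide_distrib sum_divide_distrib)
  then have "(S / D' + (\<Sum>i\<in>{1..<k}. U i)) * (b - c) \<le> \<mu> * (b - c)"
    using L Dpos by (intro mult_right_mono) auto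
  moreover have "S \<le> S / D' * (b - c)"
    using L Dpos Spos by (simp add: pos_le_divide_eq mult_left_mono)
  ultimately show False using lower unfolding S_def by (simp add: algebra_simps)
qed

end

theorem theorem4p5:
  fixes n M k :: nat and ts :: "nat \<Rightarrow> task"
  assumes "2 \<le> M"
    and "1 \<le> k" and "k \<le> n"
    and "\<forall>i\<in>{1..n}. valid_task (ts i)"
    and "\<forall>i\<in>{1..<k}. schedulable n M ts i"
    and "\<forall>l::nat. 1 \<le> l \<longrightarrow>
      (let D' = (real l - 1) * period (ts k) + deadline (ts k) in
         real l * wcet (ts k) / D' +
         (\<Sum>i\<in>{1..<k}. (wcet (ts i) - wcet (ts i) * utilization (ts i)) / D' + utilization (ts i))
         \<le> real M - (real M - 1) * U_max ts k)"
  shows "schedulable n M ts k"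
  unfolding schedulable_def
proof (intro allI impI)
  fix arr cost sched j
  assume "legal_jobs n ts arr cost" "global_fp_schedule n M arr cost sched"
  then interpret fp_schedule n M ts arr cost sched
    using assms(4) by unfold_locales auto
  show "meets_deadline M ts arr cost sched k j"
  proof (rule deadline_met)
    show "density (ts k) \<le> U_max ts k" unfolding U_max_def by (intro Max_ge) auto
    show "U i \<le> U_max ts k" if "i \<in> {1..<k}" for i
      unfolding U_max_def using that by (intro Max_ge) auto
  qed (use assms in \<open>auto simp: Let_def\<close>)
qed

end
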